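(* Let $\alpha\in(1,2)$ and let $N,N_1,N_2,N_3$ satisfy $1\le N_j\le N$ for $j\in\{1,2,3\}$. With $S$ as in the context, the following counting estimates hold, with implicit constants independent of $N,N_1,N_2,N_3$, of $m$, and of the fixed frequencies: $$|S_{kk_2}|\lesssim(N_1\wedge N_3)^{\frac83-\alpha},\qquad|S_{k_1k_3}|\lesssim N_2^{\frac83-\alpha}.$$
   Context: $a\wedge b=\min\{a,b\}$; $N,N_j$ are dyadic numbers. For a real parameter $m$, $S$ is the set of $(k,k_1,k_2,k_3)\in(\mathbb Z^2)^4$ such that $$k_1-k_2+k_3-k=0,\quad k_2\notin\{k_1,k_3\},\quad|k_1|^\alpha-|k_2|^\alpha+|k_3|^\alpha-|k|^\alpha=m+\mathcal O(1),\quad|k|\le N,\ |k_j|\le N_j\ (j=1,2,3),$$ where $\mathcal O(1)$ means bounded in absolute value by a fixed absolute constant. A subscript indicates fixed variables: e.g. $S_{kk_2}$ is the set of elements of $S$ with prescribed values of $k$ and $k_2$, and $|S_{kk_2}|$ its cardinality. *)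

theory Defs
  imports "HOL-Analysis.Analysis"
begin

definition dyadic :: "real \<Rightarrow> bool" where
  "dyadic x \<longleftrightarrow> (\<exists>n::int. x = 2 powi n)"

type_synonym freq = "int \<times> int"

text \<open>The norm on pairs of reals is the Euclidean one.\<close>

definition fnorm :: "freq \<Rightarrow> real" where
  "fnorm k = norm (real_of_int (fst k), real_of_int (snd k))"

text \<open>The parameter \<open>A\<close> is the bound hidden in the term \<open>O(1)\<close> of the resonance condition.
  Elements are quadruples \<open>(k, k1, k2, k3)\<close>.\<close>

definition S :: "real \<Rightarrow> real \<Rightarrow> real \<Rightarrow> real \<Rightarrow> real \<Rightarrow> real \<Rightarrow> real
    \<Rightarrow> (freq \<times> freq \<times> freq \<times> freq) set" where
  "S \<alpha> A m N N1 N2 N3 = {(k, k1, k2, k3).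
     k1 - k2 + k3 - k = 0 \<and> k2 \<notin> {k1, k3} \<and>
     \<bar>fnorm k1 powr \<alpha> - fnorm k2 powr \<alpha> + fnorm k3 powr \<alpha> - fnorm k powr \<alpha> - m\<bar> \<le> A \<and>
     fnorm k \<le> N \<and> fnorm k1 \<le> N1 \<and> fnorm k2 \<le> N2 \<and> fnorm k3 \<le> N3}"

definition S_k_k2 :: "real \<Rightarrow> real \<Rightarrow> real \<Rightarrow> real \<Rightarrow> real \<Rightarrow> real \<Rightarrow> real \<Rightarrow> freq \<Rightarrow> freq
    \<Rightarrow> (freq \<times> freq \<times> freq \<times> freq) set" where
  "S_k_k2 \<alpha> A m N N1 N2 N3 k k2 =
     {(l, l1, l2, l3). (l, l1, l2, l3) \<in> S \<alpha> A m N N1 N2 N3 \<and> l = k \<and> l2 = k2}"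

definition S_k1_k3 :: "real \<Rightarrow> real \<Rightarrow> real \<Rightarrow> real \<Rightarrow> real \<Rightarrow> real \<Rightarrow> real \<Rightarrow> freq \<Rightarrow> freq
    \<Rightarrow> (freq \<times> freq \<times> freq \<times> freq) set" where
  "S_k1_k3 \<alpha> A m N N1 N2 N3 k1 k3 =
     {(l, l1, l2, l3). (l, l1, l2, l3) \<in> S \<alpha> A m N N1 N2 N3 \<and> l1 = k1 \<and> l3 = k3}"

text \<open>All these sets are finite, so that \<open>card\<close> is their genuine cardinality.\<close>

lemma finite_fnorm_le: "finite {k. fnorm k \<le> R}"
proof (rule finite_subset)
  show "{k. fnorm k \<le> R} \<subseteq> {-\<lceil>R\<rceil>..\<lceil>R\<rceil>} \<times> {-\<lceil>R\<rceil>..\<lceil>R\<rceil>}"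
  proof
    fix k assume "k \<in> {k. fnorm k \<le> R}"
    then have R: "fnorm k \<le> R" by simp
    have "\<bar>real_of_int (fst k)\<bar> \<le> R" "\<bar>real_of_int (snd k)\<bar> \<le> R"
      using R norm_fst_le[of "real_of_int (fst k)" "real_of_int (snd k)"]
        norm_snd_le[of "real_of_int (snd k)" "real_of_int (fst k)"]
      by (simp_all add: fnorm_def)
    then show "k \<in> {-\<lceil>R\<rceil>..\<lceil>R\<rceil>} \<times> {-\<lceil>R\<rceil>..\<lceil>R\<rceil>}"
      by (cases k) (auto simp: abs_le_iff; linarith)
  qed
qed simp

lemma finite_S: "finite (S \<alpha> A m N N1 N2 N3)"
  by (rule finite_subset[of _ "{k. fnorm k \<le> N} \<times> {k. fnorm k \<le> N1} \<times> {k. fnorm k \<le> N2}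
        \<times> {k. fnorm k \<le> N3}"])
     (auto simp: S_def finite_fnorm_le)

lemma finite_S_k_k2: "finite (S_k_k2 \<alpha> A m N N1 N2 N3 k k2)"
  by (rule finite_subset[OF _ finite_S]) (auto simp: S_k_k2_def)

lemma finite_S_k1_k3: "finite (S_k1_k3 \<alpha> A m N N1 N2 N3 k1 k3)"
  by (rule finite_subset[OF _ finite_S]) (auto simp: S_k1_k3_def)

end

theory Submission
  imports Defs
begin

text \<open>
  Both sets are counted by one free frequency \<open>x\<close> in a disc of radius \<open>R\<close>, subject to
  \<open>F x = \<bar>x\<bar>\<^sup>\<alpha> + \<bar>c - x\<bar>\<^sup>\<alpha> = M + O(1)\<close>. On that disc \<open>F\<close> lies above its tangent
  planes by at least \<open>\<mu> \<bar>v - x\<bar>\<^sup>2\<close>, where \<open>\<mu>\<close> is a multiple of \<open>R\<close> to the power \<open>\<alpha> - 2\<close>.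
  Cut the range of \<open>F\<close> into \<open>O(1/\<mu>)\<close> slices of width \<open>\<mu>\<close>. Distinct lattice points are at distance
  at least 1, so each lattice point of a slice is strictly exposed in that slice, with the gradient
  of \<open>F\<close> as exposing functional. As in Jarnik's theorem, a set of strictly exposed lattice points
  in the disc has \<open>O(R\<^sup>2\<^sup>/\<^sup>3)\<close> elements.
\<close>

section \<open>Strong convexity of powers of the norm on a disc\<close>

text \<open>Since \<open>\<alpha> - 2\<close> is negative, the second derivative of
  \<open>t powr \<alpha>\<close> on \<open>(0, R]\<close> is smallest at \<open>R\<close>.
  Subtracting \<open>\<mu> * t\<^sup>2\<close> therefore leaves a convex function, which lies above
  its tangents. The slope is written \<open>r powr (\<alpha> - 2) * r\<close> to match the gradient
  of the norm power in the vector version; it is 0 at \<open>r = 0\<close>.\<close>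

lemma powr_above_tangent_quadratic:
  fixes \<alpha> R r s :: real
  assumes \<alpha>: "1 < \<alpha>" "\<alpha> < 2" and r: "0 \<le> r" "r \<le> R" and s: "0 \<le> s" "s \<le> R" and R: "0 < R"
  shows "r powr \<alpha> + \<alpha> * r powr (\<alpha> - 2) * (r * (s - r))
      + \<alpha> * (\<alpha> - 1) / 2 * R powr (\<alpha> - 2) * (s - r)\<^sup>2 \<le> s powr \<alpha>"
proof -
  define \<mu> where "\<mu> = \<alpha> * (\<alpha> - 1) / 2 * R powr (\<alpha> - 2)"
  \<comment> \<open>This serves the endpoints \<open>r = 0\<close> and \<open>s = 0\<close>, which
    the second derivative argument on \<open>(0, R]\<close> does not reach.\<close>
  have \<mu>_le: "\<mu> * t\<^sup>2 \<le> \<alpha> * (\<alpha> - 1) / 2 * t powr \<alpha>" if "0 \<le> t" "t \<le> R" for t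
  proof (cases "t = 0")
    case False
    then have t: "0 < t" using that by simp
    have "R powr (\<alpha> - 2) * t\<^sup>2 \<le> t powr (\<alpha> - 2) * t\<^sup>2"
      using t that \<alpha> by (intro mult_right_mono powr_mono2') auto
    also have "\<dots> = t powr \<alpha>"
      using t by (simp add: powr_diff)
    finally have "R powr (\<alpha> - 2) * t\<^sup>2 \<le> t powr \<alpha>" .
    then have "\<alpha> * (\<alpha> - 1) / 2 * (R powr (\<alpha> - 2) * t\<^sup>2) \<le> \<alpha> * (\<alpha> - 1) / 2 * t powr \<alpha>"
      using \<alpha> by (intro mult_left_mono) auto
    then show ?thesis by (simp add: \<mu>_def mult.assoc)
  qed simp
  have a2: "\<alpha> * (\<alpha> - 1) \<le> 2 * (\<alpha> - 1)"
    using \<alpha> by (intro mult_right_mono) auto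
  consider "r = 0" | "s = 0" "0 < r" | "0 < r" "0 < s" using r s by fastforce
  then show ?thesis
  proof cases
    case 1
    have "\<alpha> * (\<alpha> - 1) / 2 * s powr \<alpha> \<le> 1 * s powr \<alpha>"
      using a2 \<alpha> by (intro mult_right_mono) auto
    then show ?thesis
      using 1 \<mu>_le[OF s] unfolding \<mu>_def[symmetric] by simp
  next
    \<comment> \<open>At \<open>s = 0\<close> the tangent line has the value
      \<open>(1 - \<alpha>) * r powr \<alpha>\<close>, negative enough to absorb the quadratic term
      because \<open>\<alpha> / 2 \<le> 1\<close>.\<close>
    case 2
    have "\<alpha> * (\<alpha> - 1) / 2 * r powr \<alpha> \<le> (\<alpha> - 1) * r powr \<alpha>"
      using a2 by (intro mult_right_mono) auto
    moreover have "r powr (\<alpha> - 2) * (r * r) = r powr \<alpha>"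
      using 2 by (simp add: powr_diff power2_eq_square)
    then have "\<alpha> * r powr (\<alpha> - 2) * (r * (0 - r)) = - (\<alpha> * r powr \<alpha>)"
      by (simp add: mult.assoc)
    ultimately have "r powr \<alpha> + \<alpha> * r powr (\<alpha> - 2) * (r * (0 - r)) + \<mu> * r\<^sup>2 \<le> 0"
      using \<mu>_le[OF r] unfolding left_diff_distrib[of \<alpha>] by linarith
    then show ?thesis
      using 2 unfolding \<mu>_def[symmetric] by simp
  next
    case 3
    have "(\<alpha> * r powr (\<alpha> - 1) - \<mu> * (2 * r)) * (s - r) \<le> (s powr \<alpha> - \<mu> * s\<^sup>2) - (r powr \<alpha> - \<mu> * r\<^sup>2)"
    proof (rule f''_imp_f'[where C = "{0<..R}" and f = "\<lambda>t. t powr \<alpha> - \<mu> * t\<^sup>2"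
          and f' = "\<lambda>t. \<alpha> * t powr (\<alpha> - 1) - \<mu> * (2 * t)"
          and f'' = "\<lambda>t. \<alpha> * ((\<alpha> - 1) * t powr (\<alpha> - 2)) - \<mu> * 2"])
      fix t assume t: "t \<in> {0<..R}"
      show "((\<lambda>t. t powr \<alpha> - \<mu> * t\<^sup>2) has_real_derivative \<alpha> * t powr (\<alpha> - 1) - \<mu> * (2 * t)) (at t)"
        using t by (auto intro!: derivative_eq_intros)
      show "((\<lambda>t. \<alpha> * t powr (\<alpha> - 1) - \<mu> * (2 * t)) has_real_derivative
          \<alpha> * ((\<alpha> - 1) * t powr (\<alpha> - 2)) - \<mu> * 2) (at t)"
        using t by (auto intro!: derivative_eq_intros)
      have "\<alpha> * (\<alpha> - 1) * R powr (\<alpha> - 2) \<le> \<alpha> * (\<alpha> - 1) * t powr (\<alpha> - 2)"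
        using t \<alpha> by (intro mult_left_mono powr_mono2') auto
      then show "0 \<le> \<alpha> * ((\<alpha> - 1) * t powr (\<alpha> - 2)) - \<mu> * 2"
        by (simp add: \<mu>_def mult.assoc)
    qed (use 3 r s in auto)
    moreover have "r powr (\<alpha> - 2) * r = r powr (\<alpha> - 1)"
      using 3 by (simp add: powr_diff power2_eq_square)
    then have "\<alpha> * r powr (\<alpha> - 2) * (r * (s - r)) = \<alpha> * r powr (\<alpha> - 1) * (s - r)"
      by (metis mult.assoc)
    ultimately show ?thesis
      unfolding \<mu>_def[symmetric] by (simp add: algebra_simps power2_eq_square)
  qed
qed

text \<open>The one-variable inequality is applied to \<open>norm x\<close> and
  \<open>norm v\<close>. Passing from \<open>(norm v - norm x)\<^sup>2\<close> to the larger
  \<open>(norm (v - x))\<^sup>2\<close> raises the quadratic term by \<open>\<mu>\<close> times the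
  excess and lowers the linear term by \<open>\<beta> / 2\<close> times the same excess; as
  \<open>\<mu> \<le> \<beta> / 2\<close>, the loss covers the gain.\<close>

lemma norm_powr_above_tangent_quadratic:
  fixes x v :: "'a :: real_inner"
  assumes \<alpha>: "1 < \<alpha>" "\<alpha> < 2" and x: "norm x \<le> R" and v: "norm v \<le> R"
  shows "norm x powr \<alpha> + \<alpha> * norm x powr (\<alpha> - 2) * (x \<bullet> (v - x))
      + \<alpha> * (\<alpha> - 1) / 2 * R powr (\<alpha> - 2) * (norm (v - x))\<^sup>2 \<le> norm v powr \<alpha>"
proof (cases "x = 0")
  case True
  show ?thesis
  proof (cases "v = 0")
    case False
    then have "0 < R" using v by (metis norm_le_zero_iff not_less order_trans)
    then show ?thesis
      using powr_above_tangent_quadratic[of \<alpha> 0 R "norm v"] \<alpha> v True by simp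
  qed (use True in simp)
next
  case False
  then have R: "0 < R" using x by (metis norm_le_zero_iff not_less order_trans)
  define \<mu> where "\<mu> = \<alpha> * (\<alpha> - 1) / 2 * R powr (\<alpha> - 2)"
  define \<beta> where "\<beta> = \<alpha> * norm x powr (\<alpha> - 2)"
  have "\<alpha> * (\<alpha> - 1) / 2 * R powr (\<alpha> - 2) \<le> \<alpha> / 2 * norm x powr (\<alpha> - 2)"
    using \<alpha> x False by (intro mult_mono powr_mono2') auto
  then have \<mu>\<beta>: "\<mu> \<le> \<beta> / 2" by (simp add: \<mu>_def \<beta>_def)
  have "\<bar>norm v - norm x\<bar> \<le> norm (v - x)" by (rule norm_triangle_ineq3)
  then have "(norm v - norm x)\<^sup>2 \<le> (norm (v - x))\<^sup>2"
    by (metis abs_ge_zero power2_abs power_mono)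
  then have gap: "0 \<le> (\<beta> / 2 - \<mu>) * ((norm (v - x))\<^sup>2 - (norm v - norm x)\<^sup>2)"
    using \<mu>\<beta> by simp
  have inner_eq: "x \<bullet> (v - x) = norm x * (norm v - norm x)
      - ((norm (v - x))\<^sup>2 - (norm v - norm x)\<^sup>2) / 2"
  proof -
    have *: "(norm (v - x))\<^sup>2 = (norm v)\<^sup>2 - 2 * (x \<bullet> v) + (norm x)\<^sup>2"
      "x \<bullet> (v - x) = x \<bullet> v - (norm x)\<^sup>2"
      by (simp_all add: power2_norm_eq_inner inner_diff_left inner_diff_right inner_commute)
    show ?thesis unfolding * by (simp add: field_simps power2_eq_square)
  qed
  have radial: "norm x powr \<alpha> + \<beta> * (norm x * (norm v - norm x)) + \<mu> * (norm v - norm x)\<^sup>2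
      \<le> norm v powr \<alpha>"
    using powr_above_tangent_quadratic[of \<alpha> "norm x" R "norm v"] \<alpha> x v R
    by (simp add: \<mu>_def \<beta>_def)
  have "a + \<beta> * i + \<mu> * D \<le> b"
    if "0 \<le> (\<beta> / 2 - \<mu>) * (D - d)" "i = n - (D - d) / 2" "a + \<beta> * n + \<mu> * d \<le> b"
    for a b i n D d :: real
    using that(1,3) unfolding that(2) by (simp add: field_simps)
  from this[OF gap inner_eq radial] show ?thesis
    unfolding \<mu>_def \<beta>_def .
qed

text \<open>Plain convexity, meant for the term in \<open>c - x\<close>: that point is not confined
  to the disc of radius \<open>R\<close>, so no uniform curvature is available there.\<close>

lemma norm_powr_above_tangent:
  fixes x v :: "'a :: real_inner"
  assumes \<alpha>: "1 < \<alpha>" "\<alpha> < 2"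
  shows "norm x powr \<alpha> + \<alpha> * norm x powr (\<alpha> - 2) * (x \<bullet> (v - x)) \<le> norm v powr \<alpha>"
proof -
  have "0 \<le> \<alpha> * (\<alpha> - 1) / 2 * max (norm x) (norm v) powr (\<alpha> - 2) * (norm (v - x))\<^sup>2"
    using \<alpha> by simp
  then show ?thesis
    using norm_powr_above_tangent_quadratic[OF \<alpha>, of x "max (norm x) (norm v)" v] by linarith
qed

section \<open>Counting strictly exposed lattice points\<close>

text \<open>The hypothesis makes \<open>Q\<close> a decreasing chain with pairwise distinct edge vectors: at most
  \<open>(L + 1)\<^sup>2\<close> edges have \<open>\<ell>\<^sup>1\<close>-length at most \<open>L\<close>, and the total length \<open>4 R\<close> limits the longer ones.\<close>

lemma card_exposed_quadrant_le:
  fixes Q :: "(int \<times> int) set" and R L :: int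
  assumes fin: "finite Q" and R: "0 \<le> R" and L: "0 < L"
    and bd: "\<And>x y. (x, y) \<in> Q \<Longrightarrow> \<bar>x\<bar> \<le> R \<and> \<bar>y\<bar> \<le> R"
    and ex: "\<And>p. p \<in> Q \<Longrightarrow> \<exists>a\<ge>0::real. \<exists>b\<ge>0. \<forall>q\<in>Q. q \<noteq> p \<longrightarrow>
      a * real_of_int (fst q - fst p) + b * real_of_int (snd q - snd p) < 0"
  shows "L * int (card Q) \<le> L + L * (L + 1)\<^sup>2 + 4 * R + 1"
proof (cases "Q = {}")
  case True
  then show ?thesis using R L by simp
next
  case False
  \<comment> \<open>\<open>\<phi>\<close> increases along the chain, and its increment over an edge
    is the l1-length of that edge.\<close>
  define \<phi> :: "int \<times> int \<Rightarrow> int" where "\<phi> p = fst p - snd p" for p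
  have chain: "fst p < fst q \<and> snd q < snd p" if pq: "p \<in> Q" "q \<in> Q" "\<phi> p \<le> \<phi> q" "p \<noteq> q" for p q
  proof -
    have *: "\<not> (fst p \<le> fst q \<and> snd p \<le> snd q)" if p: "p \<in> Q" and q: "q \<in> Q" "p \<noteq> q" for p q
    proof
      assume le: "fst p \<le> fst q \<and> snd p \<le> snd q"
      obtain a b :: real where "0 \<le> a" "0 \<le> b"
        "a * real_of_int (fst q - fst p) + b * real_of_int (snd q - snd p) < 0"
        using ex[OF p] q by metis
      moreover have "0 \<le> a * real_of_int (fst q - fst p)" "0 \<le> b * real_of_int (snd q - snd p)"
        using le \<open>0 \<le> a\<close> \<open>0 \<le> b\<close> by auto
      ultimately show False by linarith
    qed
    have "\<not> (fst p \<le> fst q \<and> snd p \<le> snd q)" "\<not> (fst q \<le> fst p \<and> snd q \<le> snd p)"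
      using * pq by blast+
    then show ?thesis using pq(3) unfolding \<phi>_def by linarith
  qed
  have inj: "inj_on \<phi> Q"
    using chain by (metis inj_onI order_refl order_less_asym)
  define M where "M = Max (\<phi> ` Q)"
  have M: "\<phi> p \<le> M" if "p \<in> Q" for p using that fin by (simp add: M_def)
  \<comment> \<open>\<open>P\<close> leaves out only the last point of the chain; every other point
    starts exactly one edge. The lone summand \<open>L\<close> in the bound pays for the omitted
    point.\<close>
  define P where "P = {p \<in> Q. \<phi> p < M}"
  have finP: "finite P" using fin by (simp add: P_def)
  have P_sub: "P \<subseteq> Q" by (auto simp: P_def)
  have "p = q" if "p \<in> Q - P" "q \<in> Q - P" for p q
    using that M[of p] M[of q] inj by (auto simp: P_def inj_on_def)
  then have "card (Q - P) \<le> 1"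
    using fin by (simp add: card_le_Suc0_iff_eq)
  moreover have "card Q = card P + card (Q - P)"
    using card_Diff_subset[OF finP P_sub] card_mono[OF fin P_sub] by simp
  ultimately have cardQ: "card Q \<le> card P + 1" by simp
  define succ where "succ p = arg_min_on \<phi> {q \<in> Q. \<phi> p < \<phi> q}" for p
  have succ: "succ p \<in> Q \<and> \<phi> p < \<phi> (succ p) \<and> (\<forall>q\<in>Q. \<phi> p < \<phi> q \<longrightarrow> \<phi> (succ p) \<le> \<phi> q)"
    if "p \<in> P" for p
  proof -
    have "M \<in> \<phi> ` Q" unfolding M_def using fin False by (intro Max_in) auto
    then have ne: "{q \<in> Q. \<phi> p < \<phi> q} \<noteq> {}" using that by (auto simp: P_def)
    have f: "finite {q \<in> Q. \<phi> p < \<phi> q}" using fin by simp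
    show ?thesis
      using arg_min_if_finite(1)[OF f ne, of \<phi>] arg_min_least[OF f ne, of _ \<phi>]
      unfolding succ_def by auto
  qed
  define e where "e p = succ p - p" for p
  \<comment> \<open>Two equal edges would lie in the order \<open>p\<close>, \<open>p'\<close>,
    \<open>q\<close>, \<open>q'\<close> along the chain, and each of the two inner points is exposed
    against both outer ones.\<close>
  have e_inj: "p = q" if pq: "p \<in> P" "q \<in> P" "e p = e q" "\<phi> p \<le> \<phi> q" for p q
  proof (rule ccontr)
    assume ne: "p \<noteq> q"
    then have lt: "\<phi> p < \<phi> q" using pq inj by (metis (mono_tags, lifting) P_def inj_on_def mem_Collect_eq order_le_less)
    define p' where "p' = succ p"
    define q' where "q' = succ q"
    have Q: "p \<in> Q" "q \<in> Q" "p' \<in> Q" "q' \<in> Q" using pq succ by (auto simp: P_def p'_def q'_def)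
    have le: "\<phi> p < \<phi> p'" "\<phi> p' \<le> \<phi> q" "\<phi> q < \<phi> q'"
      using succ[OF pq(1)] succ[OF pq(2)] lt Q by (auto simp: p'_def q'_def)
    \<comment> \<open>With these signs the common edge is \<open>(e1, - e2)\<close> and the gap
      \<open>q - p'\<close> is \<open>(w1, - w2)\<close>, all four numbers being nonnegative. The
      gap vanishes when \<open>p' = q\<close>, so only the edge entries are strictly
      positive.\<close>
    obtain e1 e2 where e: "e1 = fst p' - fst p" "e2 = snd p - snd p'" by blast
    have eq: "e1 = fst q' - fst q" "e2 = snd q - snd q'"
      using pq(3) e by (auto simp: e_def p'_def q'_def prod_eq_iff)
    obtain w1 w2 where w: "w1 = fst q - fst p'" "w2 = snd p' - snd q" by blast
    have nonneg: "0 < e1" "0 < e2" "0 \<le> w1" "0 \<le> w2"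
      using chain[of p p'] chain[of p' q] Q le e w by (cases "p' = q"; force)+
    obtain a b :: real where ab: "0 \<le> a" "0 \<le> b" and
      ab': "\<forall>q\<in>Q. q \<noteq> p' \<longrightarrow> a * real_of_int (fst q - fst p') + b * real_of_int (snd q - snd p') < 0"
      using ex[OF Q(3)] by blast
    obtain c d :: real where cd: "0 \<le> c" "0 \<le> d" and
      cd': "\<forall>p\<in>Q. p \<noteq> q \<longrightarrow> c * real_of_int (fst p - fst q) + d * real_of_int (snd p - snd q) < 0"
      using ex[OF Q(2)] by blast
    have neq: "p \<noteq> p'" "q' \<noteq> p'" "q' \<noteq> q" "p \<noteq> q" using le by auto
    have "fst p - fst p' = - e1" "snd p - snd p' = e2"
      "fst q' - fst p' = e1 + w1" "snd q' - snd p' = - e2 - w2"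
      "fst p - fst q = - e1 - w1" "snd p - snd q = e2 + w2"
      "fst q' - fst q = e1" "snd q' - snd q = - e2"
      using e eq w by auto
    then have ineq: "a * real_of_int (- e1) + b * real_of_int e2 < 0"
      "a * real_of_int (e1 + w1) + b * real_of_int (- e2 - w2) < 0"
      "c * real_of_int (- e1 - w1) + d * real_of_int (e2 + w2) < 0"
      "c * real_of_int e1 + d * real_of_int (- e2) < 0"
      using ab' cd' Q neq by metis+
    define E1 E2 W1 W2 where E: "E1 = real_of_int e1" "E2 = real_of_int e2"
      "W1 = real_of_int w1" "W2 = real_of_int w2"
    have nn: "0 < E1" "0 < E2" "0 \<le> W1" "0 \<le> W2" using nonneg E by auto
    have "b * E2 < a * E1" "a * W1 < b * W2" "c * E1 < d * E2" "d * W2 < c * W1"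
      using ineq by (auto simp: E algebra_simps)
    \<comment> \<open>Exposedness of \<open>p'\<close> makes \<open>q - p'\<close> steeper than the common edge, that of \<open>q\<close> flatter.\<close>
    have "E2 * W1 < E1 * W2"
    proof -
      have "0 < a" "0 < b"
        using \<open>b * E2 < a * E1\<close> \<open>a * W1 < b * W2\<close> ab nn
        by (smt (verit) mult_nonneg_nonneg mult_eq_0_iff)+
      have "(b * E2) * (a * W1) \<le> (b * E2) * (b * W2)"
        using \<open>a * W1 < b * W2\<close> nn ab by (intro mult_left_mono) auto
      also have "\<dots> < (a * E1) * (b * W2)"
        using \<open>b * E2 < a * E1\<close> \<open>a * W1 < b * W2\<close> nn ab
        by (intro mult_strict_right_mono) (auto intro: le_less_trans[of 0 "a * W1"])
      finally have "(a * b) * (E2 * W1) < (a * b) * (E1 * W2)" by (simp add: algebra_simps)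
      then show ?thesis using \<open>0 < a\<close> \<open>0 < b\<close> by simp
    qed
    moreover have "E1 * W2 < E2 * W1"
    proof -
      have "0 < c" "0 < d"
        using \<open>c * E1 < d * E2\<close> \<open>d * W2 < c * W1\<close> cd nn
        by (smt (verit) mult_nonneg_nonneg mult_eq_0_iff)+
      have "(c * E1) * (d * W2) \<le> (c * E1) * (c * W1)"
        using \<open>d * W2 < c * W1\<close> nn cd by (intro mult_left_mono) auto
      also have "\<dots> < (d * E2) * (c * W1)"
        using \<open>c * E1 < d * E2\<close> \<open>d * W2 < c * W1\<close> nn cd
        by (intro mult_strict_right_mono) (auto intro: le_less_trans[of 0 "d * W2"])
      finally have "(c * d) * (E1 * W2) < (c * d) * (E2 * W1)" by (simp add: algebra_simps)
      then show ?thesis using \<open>0 < c\<close> \<open>0 < d\<close> by simp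
    qed
    ultimately show False by simp
  qed
  have inj_e: "inj_on e P"
    using e_inj by (metis inj_onI linorder_le_cases)
  define Short where "Short = {p \<in> P. \<phi> (succ p) - \<phi> p \<le> L}"
  define Long where "Long = {p \<in> P. L < \<phi> (succ p) - \<phi> p}"
  have "e ` Short \<subseteq> {0..L} \<times> {-L..0}"
  proof
    fix z assume "z \<in> e ` Short"
    then obtain p where p: "p \<in> P" "\<phi> (succ p) - \<phi> p \<le> L" "z = e p" by (auto simp: Short_def)
    have "fst p < fst (succ p) \<and> snd (succ p) < snd p"
      using succ[OF p(1)] p(1) by (intro chain) (auto simp: P_def)
    then show "z \<in> {0..L} \<times> {-L..0}"
      using p by (auto simp: mem_Times_iff e_def \<phi>_def)
  qed
  then have "card (e ` Short) \<le> card ({0..L} \<times> {-L..0})"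
    by (intro card_mono) auto
  moreover have "card (e ` Short) = card Short"
    by (rule card_image, rule inj_on_subset[OF inj_e]) (auto simp: Short_def)
  ultimately have "int (card Short) \<le> (L + 1)\<^sup>2"
    using L by (simp add: card_cartesian_product power2_eq_square le_nat_iff flip: nat_mult_distrib)
  then have short: "L * int (card Short) \<le> L * (L + 1)\<^sup>2"
    using L by simp
  \<comment> \<open>Being half open, the intervals of \<open>\<phi>\<close>-values spanned by
    different edges are disjoint. They lie among the \<open>4 * R + 1\<close> integers from
    \<open>-2 * R\<close> to \<open>2 * R\<close>, and each long edge uses more than
    \<open>L\<close> of them.\<close>
  have "(\<Sum>p\<in>Long. card {\<phi> p..<\<phi> (succ p)}) = card (\<Union>p\<in>Long. {\<phi> p..<\<phi> (succ p)})"
  proof (rule card_UN_disjoint[symmetric])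
    show "\<forall>p\<in>Long. \<forall>q\<in>Long. p \<noteq> q \<longrightarrow> {\<phi> p..<\<phi> (succ p)} \<inter> {\<phi> q..<\<phi> (succ q)} = {}"
    proof (intro ballI impI)
      fix p q assume pq: "p \<in> Long" "q \<in> Long" "p \<noteq> q"
      then have "p \<in> P" "q \<in> P" "p \<in> Q" "q \<in> Q" by (auto simp: Long_def P_def)
      moreover from this have "\<phi> p \<noteq> \<phi> q" using pq inj by (auto simp: inj_on_def)
      ultimately have "\<phi> (succ p) \<le> \<phi> q \<or> \<phi> (succ q) \<le> \<phi> p"
        using succ by (meson linorder_neqE)
      then show "{\<phi> p..<\<phi> (succ p)} \<inter> {\<phi> q..<\<phi> (succ q)} = {}" by auto
    qed
  qed (use finP in \<open>auto simp: Long_def\<close>)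
  also have "\<dots> \<le> card {-2 * R..2 * R}"
  proof (intro card_mono)
    have \<phi>_bd: "-2 * R \<le> \<phi> p \<and> \<phi> p \<le> 2 * R" if "p \<in> Q" for p
      using bd[of "fst p" "snd p"] that by (auto simp: \<phi>_def abs_le_iff)
    show "(\<Union>p\<in>Long. {\<phi> p..<\<phi> (succ p)}) \<subseteq> {-2 * R..2 * R}"
    proof (rule UN_least)
      fix p assume "p \<in> Long"
      then have "p \<in> Q" "succ p \<in> Q" using succ by (auto simp: Long_def P_def)
      then show "{\<phi> p..<\<phi> (succ p)} \<subseteq> {-2 * R..2 * R}"
        using \<phi>_bd[of p] \<phi>_bd[of "succ p"] by auto
    qed
  qed simp
  finally have "(\<Sum>p\<in>Long. card {\<phi> p..<\<phi> (succ p)}) \<le> nat (4 * R + 1)" by simp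
  moreover have "(\<Sum>p\<in>Long. nat L) \<le> (\<Sum>p\<in>Long. card {\<phi> p..<\<phi> (succ p)})"
    by (intro sum_mono) (auto simp: Long_def)
  ultimately have "card Long * nat L \<le> nat (4 * R + 1)" by simp
  then have "int (card Long * nat L) \<le> int (nat (4 * R + 1))" by (rule of_nat_mono)
  then have long: "L * int (card Long) \<le> 4 * R + 1"
    using L R by (simp add: mult.commute)
  have "P = Short \<union> Long" by (auto simp: Short_def Long_def)
  then have "card P \<le> card Short + card Long" by (metis card_Un_le)
  with cardQ have "int (card Q) \<le> 1 + int (card Short) + int (card Long)" by linarith
  then have "L * int (card Q) \<le> L * (1 + int (card Short) + int (card Long))"
    using L by simp
  then show ?thesis using short long by (simp add: algebra_simps)
qed


text \<open>The signs of the coefficients of an exposing functional sort the points into four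
  classes, and reflecting coordinates makes the coefficients nonnegative in each. Taking
  \<open>L\<close> of order \<open>R powr (1/3)\<close> balances about \<open>L\<^sup>2\<close>
  short edges against about \<open>R / L\<close> long ones.\<close>

lemma card_exposed_le:
  fixes P :: "(int \<times> int) set" and R :: real
  assumes fin: "finite P" and R: "1 \<le> R"
    and bd: "\<And>x y. (x, y) \<in> P \<Longrightarrow> \<bar>real_of_int x\<bar> \<le> R \<and> \<bar>real_of_int y\<bar> \<le> R"
    and ex: "\<And>p. p \<in> P \<Longrightarrow> \<exists>a b :: real. \<forall>q\<in>P. q \<noteq> p \<longrightarrow>
      a * real_of_int (fst q - fst p) + b * real_of_int (snd q - snd p) < 0"
  shows "real (card P) \<le> 60 * R powr (2/3)"
proof -
  define \<rho> where "\<rho> = R powr (1/3)"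
  define L where "L = \<lceil>\<rho>\<rceil>"
  have \<rho>: "1 \<le> \<rho>" using R by (simp add: \<rho>_def ge_one_powr_ge_zero)
  have \<rho>3: "\<rho> ^ 3 = R" and \<rho>2: "\<rho>\<^sup>2 = R powr (2/3)"
    using R by (simp_all add: \<rho>_def powr_power)
  have L: "\<rho> \<le> L" "L \<le> 2 * \<rho>" using \<rho> unfolding L_def by linarith+
  then have L0: "0 < L" using \<rho> by linarith
  \<comment> \<open>Exposure is demanded against all of \<open>P\<close>, so it is inherited by the
    class \<open>Q s t\<close> itself.\<close>
  define Q where "Q s t = {p \<in> P. \<exists>a\<ge>0::real. \<exists>b\<ge>0. \<forall>q\<in>P. q \<noteq> p \<longrightarrow>
      a * real_of_int (s * (fst q - fst p)) + b * real_of_int (t * (snd q - snd p)) < 0}" for s t :: int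
  have card_Q: "real (card (Q s t)) \<le> 15 * \<rho>\<^sup>2" if st: "s \<in> {1, -1}" "t \<in> {1, -1}" for s t
  proof -
    define f where "f p = (s * fst p, t * snd p)" for p :: "int \<times> int"
    have inj: "inj f" using st by (auto simp: inj_def f_def prod_eq_iff)
    have "L * int (card (f ` Q s t)) \<le> L + L * (L + 1)\<^sup>2 + 4 * \<lfloor>R\<rfloor> + 1"
    proof (rule card_exposed_quadrant_le[OF _ _ L0])
      show "finite (f ` Q s t)" using fin by (simp add: Q_def)
      show "0 \<le> \<lfloor>R\<rfloor>" using R by simp
      show "\<bar>x\<bar> \<le> \<lfloor>R\<rfloor> \<and> \<bar>y\<bar> \<le> \<lfloor>R\<rfloor>" if xy: "(x, y) \<in> f ` Q s t" for x y
      proof -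
        obtain p where "p \<in> Q s t" "(x, y) = f p" using xy by blast
        then have "p \<in> P" "x = s * fst p" "y = t * snd p" by (auto simp: f_def Q_def)
        then have "\<bar>x\<bar> = \<bar>fst p\<bar>" "\<bar>y\<bar> = \<bar>snd p\<bar>" using st by auto
        then show ?thesis using bd[of "fst p" "snd p"] \<open>p \<in> P\<close> by (simp add: le_floor_iff)
      qed
      show "\<exists>a\<ge>0::real. \<exists>b\<ge>0. \<forall>q\<in>f ` Q s t. q \<noteq> p \<longrightarrow>
          a * real_of_int (fst q - fst p) + b * real_of_int (snd q - snd p) < 0"
        if p: "p \<in> f ` Q s t" for p
      proof -
        obtain p0 where p0: "p0 \<in> Q s t" "p = f p0" using p by blast
        obtain a b where ab: "0 \<le> a" "0 \<le> b"
          and neg: "\<And>q. q \<in> P \<Longrightarrow> q \<noteq> p0 \<Longrightarrow>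
            a * real_of_int (s * (fst q - fst p0)) + b * real_of_int (t * (snd q - snd p0)) < 0"
          using p0(1) unfolding Q_def by blast
        have "a * real_of_int (fst q - fst p) + b * real_of_int (snd q - snd p) < 0"
          if q: "q \<in> f ` Q s t" "q \<noteq> p" for q
        proof -
          obtain q0 where q0: "q = f q0" "q0 \<in> P" using q(1) unfolding Q_def by blast
          have "fst q - fst p = s * (fst q0 - fst p0)" "snd q - snd p = t * (snd q0 - snd p0)"
            by (simp_all add: q0 p0 f_def right_diff_distrib)
          moreover have "q0 \<noteq> p0" using q(2) q0 p0 by auto
          ultimately show ?thesis using neg[OF q0(2)] by simp
        qed
        then show ?thesis using ab by blast
      qed
    qed
    then have "L * int (card (Q s t)) \<le> L + L * (L + 1)\<^sup>2 + 4 * \<lfloor>R\<rfloor> + 1"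
      using inj by (simp add: card_image inj_on_subset)
    then have "real_of_int (L * int (card (Q s t))) \<le> real_of_int (L + L * (L + 1)\<^sup>2 + 4 * \<lfloor>R\<rfloor> + 1)"
      by (rule of_int_le_iff[THEN iffD2])
    then have "L * real (card (Q s t)) \<le> L + L * (real_of_int L + 1)\<^sup>2 + 4 * real_of_int \<lfloor>R\<rfloor> + 1"
      by simp
    also have "\<dots> \<le> L + L * (3 * \<rho>)\<^sup>2 + 5 * R"
    proof -
      have "L * (real_of_int L + 1)\<^sup>2 \<le> L * (3 * \<rho>)\<^sup>2"
        using L \<rho> L0 by (intro mult_left_mono power_mono) auto
      moreover have "real_of_int \<lfloor>R\<rfloor> \<le> R" by simp
      ultimately show ?thesis using R by linarith
    qed
    \<comment> \<open>From \<open>1 \<le> \<rho>\<^sup>2\<close> and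
      \<open>R = \<rho> ^ 3 \<le> L * \<rho>\<^sup>2\<close>, the three terms contribute 1, 9 and 5
      to the constant 15; the four classes then give 60.\<close>
    also have "\<dots> \<le> L * \<rho>\<^sup>2 + L * (3 * \<rho>)\<^sup>2 + 5 * (L * \<rho>\<^sup>2)"
    proof -
      have "R \<le> L * \<rho>\<^sup>2"
        using mult_right_mono[OF L(1), of "\<rho>\<^sup>2"] by (simp add: \<rho>3[symmetric] power3_eq_cube power2_eq_square)
      moreover have "real_of_int L * 1 \<le> L * \<rho>\<^sup>2"
        using \<rho> L0 by (intro mult_left_mono) auto
      ultimately show ?thesis by simp
    qed
    also have "\<dots> = L * (15 * \<rho>\<^sup>2)" by (simp add: power_mult_distrib)
    finally show ?thesis using L0 by simp
  qed
  have "P \<subseteq> (Q 1 1 \<union> Q 1 (-1)) \<union> (Q (-1) 1 \<union> Q (-1) (-1))"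
  proof
    fix p assume p: "p \<in> P"
    obtain a b :: real where ab: "\<forall>q\<in>P. q \<noteq> p \<longrightarrow>
        a * real_of_int (fst q - fst p) + b * real_of_int (snd q - snd p) < 0"
      using ex[OF p] by blast
    define s t :: int where "s = (if 0 \<le> a then 1 else -1)" and "t = (if 0 \<le> b then 1 else -1)"
    have "\<forall>q\<in>P. q \<noteq> p \<longrightarrow>
        \<bar>a\<bar> * real_of_int (s * (fst q - fst p)) + \<bar>b\<bar> * real_of_int (t * (snd q - snd p)) < 0"
      using ab by (auto simp: s_def t_def algebra_simps)
    then have "p \<in> Q s t"
      using p unfolding Q_def by (blast intro: abs_ge_zero)
    then show "p \<in> (Q 1 1 \<union> Q 1 (-1)) \<union> (Q (-1) 1 \<union> Q (-1) (-1))"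
      by (auto simp: s_def t_def split: if_splits)
  qed
  moreover have "finite (Q s t)" for s t using fin by (simp add: Q_def)
  ultimately have "card P \<le> card ((Q 1 1 \<union> Q 1 (-1)) \<union> (Q (-1) 1 \<union> Q (-1) (-1)))"
    by (intro card_mono) auto
  also have "\<dots> \<le> (card (Q 1 1) + card (Q 1 (-1))) + (card (Q (-1) 1) + card (Q (-1) (-1)))"
    by (meson add_mono card_Un_le order_trans)
  finally have "real (card P) \<le>
      (real (card (Q 1 1)) + card (Q 1 (-1))) + (card (Q (-1) 1) + card (Q (-1) (-1)))"
    by linarith
  then show ?thesis
    using card_Q[of 1 1] card_Q[of 1 "-1"] card_Q[of "-1" 1] card_Q[of "-1" "-1"]
    by (simp add: \<rho>2)
qed

section \<open>Lattice points in a level slab of the phase\<close>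

text \<open>At most \<open>2 * A / \<mu> + 1\<close> slices occur, of order
  \<open>R powr (2 - \<alpha>)\<close>, each with at most \<open>60 * R powr (2/3)\<close> points;
  the exponents add up to \<open>8/3 - \<alpha>\<close>. The bound is uniform in \<open>c\<close>
  because the shifted term enters only through its convexity.\<close>

lemma card_level_slab_le:
  fixes \<alpha> A M R :: real and c :: freq
  assumes \<alpha>: "1 < \<alpha>" "\<alpha> < 2" and A: "0 \<le> A" and R: "1 \<le> R"
  shows "real (card {x. fnorm x \<le> R \<and> \<bar>fnorm x powr \<alpha> + fnorm (c - x) powr \<alpha> - M\<bar> \<le> A})
    \<le> 60 * (4 * A / (\<alpha> * (\<alpha> - 1)) + 1) * R powr (8/3 - \<alpha>)"
proof -
  define \<mu> where "\<mu> = \<alpha> * (\<alpha> - 1) / 2 * R powr (\<alpha> - 2)"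
  have \<mu>: "0 < \<mu>" using \<alpha> R by (simp add: \<mu>_def)
  define F where "F x = fnorm x powr \<alpha> + fnorm (c - x) powr \<alpha>" for x
  define T where "T = {x. fnorm x \<le> R \<and> \<bar>F x - M\<bar> \<le> A}"
  have finT: "finite T"
    by (rule finite_subset[OF _ finite_fnorm_le[of R]]) (auto simp: T_def)
  \<comment> \<open>Slices are counted from the lowest admissible value \<open>M - A\<close> and are
    half open, so values of \<open>F\<close> within one slice differ by strictly less than
    \<open>\<mu>\<close>. This strictness makes the exposure strict.\<close>
  define slice where "slice x = \<lfloor>(F x - (M - A)) / \<mu>\<rfloor>" for x
  define J where "J = {0..\<lfloor>2 * A / \<mu>\<rfloor>}"
  have slice_J: "slice x \<in> J" if "x \<in> T" for x
  proof -
    have "0 \<le> F x - (M - A)" "F x - (M - A) \<le> 2 * A" using that by (auto simp: T_def abs_le_iff)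
    then have "0 \<le> (F x - (M - A)) / \<mu>" "(F x - (M - A)) / \<mu> \<le> 2 * A / \<mu>"
      using \<mu> by (auto intro: divide_right_mono)
    then show ?thesis by (auto simp: slice_def J_def intro: floor_mono)
  qed
  have card_slice: "real (card {x \<in> T. slice x = j}) \<le> 60 * R powr (2/3)" for j
  proof (rule card_exposed_le[OF _ R])
    show "finite {x \<in> T. slice x = j}" using finT by simp
    show "\<bar>real_of_int x\<bar> \<le> R \<and> \<bar>real_of_int y\<bar> \<le> R" if "(x, y) \<in> {x \<in> T. slice x = j}" for x y
      using that norm_fst_le[of "real_of_int x" "real_of_int y"]
        norm_snd_le[of "real_of_int y" "real_of_int x"]
      by (auto simp: T_def fnorm_def)
    fix p assume p: "p \<in> {x \<in> T. slice x = j}"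
    define \<iota> where "\<iota> x = (real_of_int (fst x), real_of_int (snd x))" for x :: freq
    have fnorm: "fnorm x = norm (\<iota> x)" for x by (simp add: fnorm_def \<iota>_def)
    have \<iota>_diff: "\<iota> (x - y) = \<iota> x - \<iota> y" for x y by (simp add: \<iota>_def)
    \<comment> \<open>The gradient of \<open>F\<close> at \<open>p\<close>; the minus sign comes
      from differentiating \<open>c - x\<close>. At \<open>p = 0\<close> or \<open>p = c\<close> the
      corresponding term is 0, the correct gradient since \<open>1 < \<alpha>\<close>.\<close>
    define g where "g = (\<alpha> * norm (\<iota> p) powr (\<alpha> - 2)) *\<^sub>R \<iota> p
      - (\<alpha> * norm (\<iota> (c - p)) powr (\<alpha> - 2)) *\<^sub>R \<iota> (c - p)"
    have "fst g * real_of_int (fst q - fst p) + snd g * real_of_int (snd q - snd p) < 0"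
      if q: "q \<in> {x \<in> T. slice x = j}" "q \<noteq> p" for q
    proof -
      have "(F q - (M - A)) / \<mu> < j + 1" "j \<le> (F p - (M - A)) / \<mu>"
        using p q by (auto simp: slice_def) linarith+
      then have "(F q - (M - A)) / \<mu> - (F p - (M - A)) / \<mu> < 1" by linarith
      then have "(F q - F p) / \<mu> < 1" by (simp add: diff_divide_distrib)
      then have F: "F q - F p < \<mu>" using \<mu> by (simp add: divide_less_eq)
      have "1 \<le> (fst q - fst p)\<^sup>2 + (snd q - snd p)\<^sup>2"
        using q(2) by (smt (verit) prod_eq_iff sum_power2_gt_zero_iff)
      then have "1 \<le> real_of_int ((fst q - fst p)\<^sup>2 + (snd q - snd p)\<^sup>2)" by linarith
      also have "\<dots> = (norm (\<iota> q - \<iota> p))\<^sup>2"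
        by (simp add: \<iota>_def norm_Pair)
      finally have "\<mu> * 1 \<le> \<mu> * (norm (\<iota> q - \<iota> p))\<^sup>2" using \<mu> by (intro mult_left_mono) auto
      moreover have "norm (\<iota> p) \<le> R" "norm (\<iota> q) \<le> R"
        using p q by (auto simp: T_def fnorm)
      note norm_powr_above_tangent_quadratic[OF \<alpha> this]
      moreover note norm_powr_above_tangent[OF \<alpha>, of "\<iota> (c - p)" "\<iota> (c - q)"]
      moreover have "\<iota> (c - q) - \<iota> (c - p) = - (\<iota> q - \<iota> p)" by (simp add: \<iota>_diff)
      ultimately have "g \<bullet> (\<iota> q - \<iota> p) \<le> F q - F p - \<mu>"
        unfolding F_def fnorm g_def \<mu>_def[symmetric] inner_diff_left inner_scaleR_left
        by (simp del: minus_diff_eq)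
      then have "g \<bullet> (\<iota> q - \<iota> p) < 0" using F by linarith
      then show ?thesis by (simp add: \<iota>_def inner_prod_def)
    qed
    then show "\<exists>a b :: real. \<forall>q\<in>{x \<in> T. slice x = j}. q \<noteq> p \<longrightarrow>
        a * real_of_int (fst q - fst p) + b * real_of_int (snd q - snd p) < 0" by blast
  qed
  have "T = (\<Union>j\<in>J. {x \<in> T. slice x = j})" using slice_J by auto
  then have "card T = card (\<Union>j\<in>J. {x \<in> T. slice x = j})" by (rule arg_cong)
  also have "\<dots> \<le> (\<Sum>j\<in>J. card {x \<in> T. slice x = j})"
    by (rule card_UN_le) (simp add: J_def)
  finally have "real (card T) \<le> (\<Sum>j\<in>J. real (card {x \<in> T. slice x = j}))"
    by (simp flip: of_nat_sum)
  also have "\<dots> \<le> (\<Sum>j\<in>J. 60 * R powr (2/3))"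
    by (intro sum_mono card_slice)
  also have "\<dots> = real (card J) * (60 * R powr (2/3))" by simp
  also have "\<dots> \<le> ((4 * A / (\<alpha> * (\<alpha> - 1)) + 1) * R powr (2 - \<alpha>)) * (60 * R powr (2/3))"
  proof (rule mult_right_mono)
    have "0 \<le> 2 * A / \<mu>" using A \<mu> by simp
    then have "real (card J) \<le> 2 * A / \<mu> + 1" by (simp add: J_def)
    also have "2 * A / \<mu> = 4 * A / (\<alpha> * (\<alpha> - 1)) * R powr (2 - \<alpha>)"
      using powr_minus[of R "\<alpha> - 2"] \<alpha> R by (simp add: \<mu>_def field_simps)
    finally have "real (card J) \<le> 4 * A / (\<alpha> * (\<alpha> - 1)) * R powr (2 - \<alpha>) + 1" .
    moreover have "1 \<le> R powr (2 - \<alpha>)" using R \<alpha> by (simp add: ge_one_powr_ge_zero)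
    ultimately show "real (card J) \<le> (4 * A / (\<alpha> * (\<alpha> - 1)) + 1) * R powr (2 - \<alpha>)"
      unfolding distrib_right by linarith
  qed simp
  also have "\<dots> = 60 * (4 * A / (\<alpha> * (\<alpha> - 1)) + 1) * R powr (8/3 - \<alpha>)"
  proof -
    have "R powr (8/3 - \<alpha>) = R powr (2 - \<alpha>) * R powr (2/3)"
      by (simp flip: powr_add)
    then show ?thesis by (simp only: mult_ac)
  qed
  finally show ?thesis by (simp add: T_def F_def)
qed

section \<open>Reduction of both fibres to level slabs\<close>

theorem lemma4p9:
  fixes \<alpha> A :: real
  assumes "1 < \<alpha>" and "\<alpha> < 2" and "0 \<le> A"
  shows "\<exists>C>0. \<forall>N N1 N2 N3 m :: real.
    dyadic N \<and> dyadic N1 \<and> dyadic N2 \<and> dyadic N3 \<and>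
    1 \<le> N1 \<and> N1 \<le> N \<and> 1 \<le> N2 \<and> N2 \<le> N \<and> 1 \<le> N3 \<and> N3 \<le> N \<longrightarrow>
      (\<forall>k k2. real (card (S_k_k2 \<alpha> A m N N1 N2 N3 k k2)) \<le> C * min N1 N3 powr (8/3 - \<alpha>)) \<and>
      (\<forall>k1 k3. real (card (S_k1_k3 \<alpha> A m N N1 N2 N3 k1 k3)) \<le> C * N2 powr (8/3 - \<alpha>))"
proof -
  define C where "C = 60 * (4 * A / (\<alpha> * (\<alpha> - 1)) + 1)"
  have "0 \<le> 4 * A / (\<alpha> * (\<alpha> - 1))" using assms by simp
  then have "0 < C" unfolding C_def by (intro mult_pos_pos add_nonneg_pos) auto
  \<comment> \<open>Here \<open>h\<close> rebuilds a quadruple from its free frequency. Covering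
    \<open>X\<close> by the image is enough, and \<open>C\<close> depends only on
    \<open>\<alpha>\<close> and \<open>A\<close>, hence not on \<open>c\<close> or
    \<open>M\<close>.\<close>
  have bound: "real (card X) \<le> C * R powr (8/3 - \<alpha>)"
    if "1 \<le> R"
      "X \<subseteq> h ` {x. fnorm x \<le> R \<and> \<bar>fnorm x powr \<alpha> + fnorm (c - x) powr \<alpha> - M\<bar> \<le> A}"
    for X and h :: "freq \<Rightarrow> freq \<times> freq \<times> freq \<times> freq" and R c M
  proof -
    have "finite {x. fnorm x \<le> R \<and> \<bar>fnorm x powr \<alpha> + fnorm (c - x) powr \<alpha> - M\<bar> \<le> A}"
      by (rule finite_subset[OF _ finite_fnorm_le[of R]]) auto
    then have "card X \<le> card {x. fnorm x \<le> R \<and> \<bar>fnorm x powr \<alpha> + fnorm (c - x) powr \<alpha> - M\<bar> \<le> A}"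
      by (rule surj_card_le[OF _ that(2)])
    then show ?thesis
      using card_level_slab_le[OF assms that(1), of c M] unfolding C_def by linarith
  qed
  show ?thesis
  proof (intro exI[of _ C] conjI allI impI \<open>0 < C\<close>; elim conjE)
    fix N N1 N2 N3 m :: real and k k2 :: freq
    assume N: "1 \<le> N1" "1 \<le> N3"
    let ?M = "m + fnorm k2 powr \<alpha> + fnorm k powr \<alpha>"
    let ?X = "S_k_k2 \<alpha> A m N N1 N2 N3 k k2"
    have X: "\<exists>l1 l3. z = (k, l1, k2, l3) \<and> l1 + l3 = k + k2 \<and> fnorm l1 \<le> N1 \<and> fnorm l3 \<le> N3
        \<and> \<bar>fnorm l1 powr \<alpha> + fnorm l3 powr \<alpha> - ?M\<bar> \<le> A"
      if z: "z \<in> ?X" for z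
    proof -
      obtain l1 l3 where l: "z = (k, l1, k2, l3)" "(k, l1, k2, l3) \<in> S \<alpha> A m N N1 N2 N3"
        using z unfolding S_k_k2_def by blast
      then have "l1 + l3 = k + k2" by (simp add: S_def algebra_simps)
      with l show ?thesis by (auto simp: S_def algebra_simps)
    qed
    \<comment> \<open>The sum of \<open>l1\<close> and \<open>l3\<close> is fixed at
      \<open>k + k2\<close>, so either one can be the free frequency. Counting by \<open>l1\<close>
      and then by \<open>l3\<close> yields the minimum.\<close>
    have "real (card ?X) \<le> C * N1 powr (8/3 - \<alpha>)"
    proof (rule bound[OF N(1), where h = "\<lambda>x. (k, x, k2, k + k2 - x)"], rule subsetI)
      fix z assume "z \<in> ?X"
      then obtain l1 l3 where l: "z = (k, l1, k2, l3)" "l1 + l3 = k + k2" "fnorm l1 \<le> N1"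
        "\<bar>fnorm l1 powr \<alpha> + fnorm l3 powr \<alpha> - ?M\<bar> \<le> A" using X by blast
      then have "l3 = k + k2 - l1" by (metis add_diff_cancel_left')
      then show "z \<in> (\<lambda>x. (k, x, k2, k + k2 - x)) ` {x. fnorm x \<le> N1 \<and>
          \<bar>fnorm x powr \<alpha> + fnorm (k + k2 - x) powr \<alpha> - ?M\<bar> \<le> A}"
        using l by blast
    qed
    moreover have "real (card ?X) \<le> C * N3 powr (8/3 - \<alpha>)"
    proof (rule bound[OF N(2), where h = "\<lambda>x. (k, k + k2 - x, k2, x)"], rule subsetI)
      fix z assume "z \<in> ?X"
      then obtain l1 l3 where l: "z = (k, l1, k2, l3)" "l1 + l3 = k + k2" "fnorm l3 \<le> N3"
        "\<bar>fnorm l3 powr \<alpha> + fnorm l1 powr \<alpha> - ?M\<bar> \<le> A" using X by (metis add.commute)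
      then have "l1 = k + k2 - l3" by (metis add_diff_cancel_right')
      then show "z \<in> (\<lambda>x. (k, k + k2 - x, k2, x)) ` {x. fnorm x \<le> N3 \<and>
          \<bar>fnorm x powr \<alpha> + fnorm (k + k2 - x) powr \<alpha> - ?M\<bar> \<le> A}"
        using l by blast
    qed
    ultimately show "real (card ?X) \<le> C * min N1 N3 powr (8/3 - \<alpha>)"
      by (simp add: min_def)
  next
    fix N N1 N2 N3 m :: real and k1 k3 :: freq
    assume N: "1 \<le> N2"
    \<comment> \<open>The free frequency and its partner carry minus signs in the resonance
      condition; negating it inside the absolute value makes both positive and turns
      \<open>m\<close> into \<open>- m\<close>.\<close>
    let ?M = "fnorm k1 powr \<alpha> + fnorm k3 powr \<alpha> - m"
    let ?X = "S_k1_k3 \<alpha> A m N N1 N2 N3 k1 k3"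
    show "real (card ?X) \<le> C * N2 powr (8/3 - \<alpha>)"
    proof (rule bound[OF N, where h = "\<lambda>x. (k1 + k3 - x, k1, x, k3)"], rule subsetI)
      fix z assume "z \<in> ?X"
      then obtain l l2 where l: "z = (l, k1, l2, k3)" "(l, k1, l2, k3) \<in> S \<alpha> A m N N1 N2 N3"
        unfolding S_k1_k3_def by blast
      then have eq: "l = k1 + k3 - l2" by (simp add: S_def algebra_simps)
      have "fnorm l2 \<le> N2" "\<bar>fnorm l2 powr \<alpha> + fnorm l powr \<alpha> - ?M\<bar> \<le> A"
        using l(2) by (auto simp: S_def abs_le_iff)
      then show "z \<in> (\<lambda>x. (k1 + k3 - x, k1, x, k3)) ` {x. fnorm x \<le> N2 \<and>
          \<bar>fnorm x powr \<alpha> + fnorm (k1 + k3 - x) powr \<alpha> - ?M\<bar> \<le> A}"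
        using l(1) unfolding eq by blast
    qed
  qed
qed

end
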